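(* Let $k\ge 2$ and $n\ge 20k^2$ be integers. Then $r(S_n,P_k)=n+k-2-\gamma$, where $\gamma=0$ if $k-1$ divides $n-2$, and $\gamma=1$ otherwise.
   Context: For graphs $H_1,H_2$, the Ramsey number $r(H_1,H_2)$ is the smallest positive integer $N$ such that every (finite simple) graph $\Gamma$ on $N$ vertices contains $H_1$ as a (not necessarily induced) subgraph or its complement $\overline{\Gamma}$ contains $H_2$ as a subgraph. $S_n$ is the star on $n$ vertices (one center adjacent to $n-1$ leaves) and $P_k$ is the path on $k$ vertices. *)

theory Defs
  imports Main "HOL-Library.Ramsey"
begin

text \<open>A graph is a pair of a vertex set and a set of edges, where an edge is a two-element
  set of vertices; \<open>[V]\<^bsup>2\<^esup>\<close> denotes the set of all two-element subsets of \<open>V\<close>.\<close>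

type_synonym 'a graph = "'a set \<times> 'a set set"

abbreviation verts :: "'a graph \<Rightarrow> 'a set" where
  "verts G \<equiv> fst G"

abbreviation edges :: "'a graph \<Rightarrow> 'a set set" where
  "edges G \<equiv> snd G"

definition finite_simple_graph :: "'a graph \<Rightarrow> bool" where
  "finite_simple_graph G \<longleftrightarrow> finite (verts G) \<and> edges G \<subseteq> [verts G]\<^bsup>2\<^esup>"

definition complement_graph :: "'a graph \<Rightarrow> 'a graph" where
  "complement_graph G = (verts G, [verts G]\<^bsup>2\<^esup> - edges G)"

text \<open>\<open>G\<close> has a (not necessarily induced) subgraph isomorphic to \<open>H\<close>.\<close>

definition contains_graph :: "'a graph \<Rightarrow> 'b graph \<Rightarrow> bool" where
  "contains_graph G H \<longleftrightarrow>
     (\<exists>f. inj_on f (verts H) \<and> f ` verts H \<subseteq> verts G \<and> (\<forall>e\<in>edges H. f ` e \<in> edges G))"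

text \<open>Every finite graph is isomorphic to one whose vertices are natural numbers, so it is no
  restriction that \<open>\<Gamma>\<close> ranges only over graphs with vertices of type \<^typ>\<open>nat\<close>.\<close>

definition ramsey_number :: "'a graph \<Rightarrow> 'b graph \<Rightarrow> nat" where
  "ramsey_number H1 H2 =
     (LEAST N. N > 0 \<and>
        (\<forall>\<Gamma> :: nat graph. finite_simple_graph \<Gamma> \<and> card (verts \<Gamma>) = N \<longrightarrow>
           contains_graph \<Gamma> H1 \<or> contains_graph (complement_graph \<Gamma>) H2))"

text \<open>The indices of the star and of the path count vertices, not edges; the center of the
  star is \<open>0\<close>.\<close>

definition star_graph :: "nat \<Rightarrow> nat graph" where
  "star_graph n = ({..<n}, {{0, i} | i. 0 < i \<and> i < n})"

definition path_graph :: "nat \<Rightarrow> nat graph" where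
  "path_graph k = ({..<k}, {{i, Suc i} | i. Suc i < k})"

end

theory Submission
  imports Defs
begin

text \<open>
  A graph \<open>\<Gamma>\<close> on \<open>N\<close> vertices has no \<open>S\<^sub>n\<close> iff its complement \<open>H\<close> has minimum degree at least
  \<open>N - n + 1\<close>. For \<open>N = n + k - 2\<close> this is \<open>k - 1\<close>, and a greedily grown path in \<open>H\<close> reaches
  \<open>k\<close> vertices. For \<open>N = n + k - 3\<close> it is \<open>k - 2\<close>, and the greedy path reaches \<open>k - 1\<close> vertices;
  if \<open>H\<close> has no \<open>P\<^sub>k\<close>, all neighbours of its endpoints lie on it, so it closes up to a cycle,
  every rotation of the cycle is again such a path, and hence no edge leaves its vertex set.
  So \<open>H\<close> is a disjoint union of copies of \<open>K\<^bsub>k-1\<^esub>\<close>, which forces \<open>k - 1\<close> to divide \<open>N\<close>.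
  Conversely, a disjoint union of cliques of nearly equal size at most \<open>k - 1\<close>, realised as
  the residue classes modulo the number of cliques, is the complement of an extremal graph.
\<close>

section \<open>Neighbourhoods, degrees and stars\<close>

definition nbrs :: "'a graph \<Rightarrow> 'a \<Rightarrow> 'a set" where
  "nbrs G x = {y. {x, y} \<in> edges G}"

lemma mem_nbrs_iff: "y \<in> nbrs G x \<longleftrightarrow> {x, y} \<in> edges G"
  by (simp add: nbrs_def)

lemma nbrs_sym: "y \<in> nbrs G x \<longleftrightarrow> x \<in> nbrs G y"
  by (simp add: nbrs_def insert_commute)

lemma finite_simple_graph_complement:
  "finite_simple_graph G \<Longrightarrow> finite_simple_graph (complement_graph G)"
  by (auto simp: finite_simple_graph_def complement_graph_def)

lemma nbrs_subset:
  assumes "finite_simple_graph G"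
  shows "nbrs G x \<subseteq> verts G - {x}"
proof
  fix y assume "y \<in> nbrs G x"
  then have "{x, y} \<in> [verts G]\<^bsup>2\<^esup>"
    using assms unfolding finite_simple_graph_def mem_nbrs_iff by blast
  then show "y \<in> verts G - {x}"
    unfolding doubleton_in_nsets_2 by auto
qed

lemma finite_nbrs: "finite_simple_graph G \<Longrightarrow> finite (nbrs G x)"
  using nbrs_subset[of G x] by (auto simp: finite_simple_graph_def intro: finite_subset)

lemma card_nbrs_complement:
  assumes G: "finite_simple_graph G" and x: "x \<in> verts G"
  shows "Suc (card (nbrs G x) + card (nbrs (complement_graph G) x)) = card (verts G)"
proof -
  have fin: "finite (verts G)"
    using G by (simp add: finite_simple_graph_def)
  have "nbrs (complement_graph G) x = verts G - {x} - nbrs G x"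
    using x by (auto simp: nbrs_def complement_graph_def)
  moreover have "card (verts G - {x} - nbrs G x) = card (verts G - {x}) - card (nbrs G x)"
    using nbrs_subset[OF G] finite_nbrs[OF G] by (intro card_Diff_subset) auto
  moreover have "card (nbrs G x) \<le> card (verts G - {x})"
    using nbrs_subset[OF G] fin by (intro card_mono) auto
  moreover have "card (verts G) > 0"
    using x fin card_gt_0_iff by blast
  ultimately show ?thesis
    using x fin by (simp add: card_Diff_singleton)
qed

text \<open>A star is a centre together with \<open>n - 1\<close> distinct neighbours. Positivity of
  \<open>n\<close> ensures that there is a centre at all.\<close>

lemma contains_star_iff:
  assumes G: "finite_simple_graph G" and n: "n > 0"
  shows "contains_graph G (star_graph n) \<longleftrightarrow> (\<exists>x\<in>verts G. n - 1 \<le> card (nbrs G x))"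
proof
  assume "contains_graph G (star_graph n)"
  then obtain f where f': "inj_on f (verts (star_graph n))"
      "f ` verts (star_graph n) \<subseteq> verts G" "\<forall>e\<in>edges (star_graph n). f ` e \<in> edges G"
    unfolding contains_graph_def by blast
  have f: "inj_on f {..<n}" "f ` {..<n} \<subseteq> verts G"
    using f' by (simp_all add: star_graph_def)
  have e: "f ` {0, i} \<in> edges G" if "0 < i" "i < n" for i
    by (rule bspec[OF f'(3)]) (use that in \<open>auto simp: star_graph_def\<close>)
  have "f ` {1..<n} \<subseteq> nbrs G (f 0)"
    using e by (auto simp: nbrs_def)
  then have "card (f ` {1..<n}) \<le> card (nbrs G (f 0))"
    using finite_nbrs[OF G] card_mono by blast
  moreover have "card (f ` {1..<n}) = n - 1"
    by (subst card_image[OF inj_on_subset[OF f(1)]]) auto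
  ultimately show "\<exists>x\<in>verts G. n - 1 \<le> card (nbrs G x)"
    using f(2) n by (intro bexI[of _ "f 0"]) auto
next
  assume "\<exists>x\<in>verts G. n - 1 \<le> card (nbrs G x)"
  then obtain x where x: "x \<in> verts G" and c: "n - 1 \<le> card (nbrs G x)"
    by blast
  have "card {1..<n} \<le> card (nbrs G x)"
    using c by simp
  then obtain g where g: "g ` {1..<n} \<subseteq> nbrs G x" "inj_on g {1..<n}"
    using card_le_inj[of "{1..<n}" "nbrs G x"] finite_nbrs[OF G] by blast
  define f where "f = (\<lambda>i. if i = 0 then x else g i)"
  have f_nbrs: "f i \<in> nbrs G x" if "0 < i" "i < n" for i
    using g(1) that by (auto simp: f_def)
  have img: "f ` {1..<n} \<subseteq> nbrs G x" and inj: "inj_on f {1..<n}"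
    using g by (auto simp: f_def inj_on_def)
  have split: "{..<n} = insert 0 {1..<n}" and f0: "f 0 = x"
    using n by (auto simp: f_def)
  have "inj_on f {..<n}"
    using img inj nbrs_subset[OF G, of x] unfolding split inj_on_insert f0 by blast
  moreover have "f ` {..<n} \<subseteq> verts G"
    using img nbrs_subset[OF G, of x] x unfolding split image_insert f0 by blast
  moreover have "f ` {0, i} \<in> edges G" if "0 < i" "i < n" for i
    using f_nbrs[OF that] by (simp add: mem_nbrs_iff f0)
  ultimately show "contains_graph G (star_graph n)"
    unfolding contains_graph_def star_graph_def by (intro exI[of _ f]) auto
qed

section \<open>Paths\<close>

text \<open>With vertex lists, extending a path is a Cons at the head, and rotating a closed path
  swaps the two halves of an append.\<close>

definition path_in :: "'a graph \<Rightarrow> 'a list \<Rightarrow> bool" where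
  "path_in G xs \<longleftrightarrow>
     distinct xs \<and> set xs \<subseteq> verts G \<and> successively (\<lambda>x y. y \<in> nbrs G x) xs"

lemma contains_pathI:
  assumes "path_in G xs"
  shows "contains_graph G (path_graph (length xs))"
proof -
  have "inj_on ((!) xs) {..<length xs}"
    using assms by (auto simp: path_in_def inj_on_def nth_eq_iff_index_eq)
  moreover have "(!) xs ` {..<length xs} \<subseteq> verts G"
    using assms by (auto simp: path_in_def)
  moreover have "(!) xs ` {i, Suc i} \<in> edges G" if "Suc i < length xs" for i
    using assms that by (auto simp: path_in_def successively_conv_nth nbrs_def)
  ultimately show ?thesis
    unfolding contains_graph_def path_graph_def by (intro exI[of _ "(!) xs"]) auto
qed

lemma path_in_Cons:
  assumes "finite_simple_graph G" "path_in G xs" "xs \<noteq> []" "y \<in> nbrs G (hd xs)" "y \<notin> set xs"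
  shows "path_in G (y # xs)"
  using assms nbrs_subset[of G "hd xs"] nbrs_sym[of y G "hd xs"]
  by (auto simp: path_in_def successively_Cons)

text \<open>While the path has at most \<open>d\<close> vertices, fewer than \<open>d\<close> of
  them can be neighbours of its head, so some neighbour is new. Growth at the head keeps
  \<open>v\<close> as the last vertex.\<close>

lemma greedy_path:
  assumes G: "finite_simple_graph G" and deg: "\<And>x. x \<in> verts G \<Longrightarrow> d \<le> card (nbrs G x)"
    and v: "v \<in> verts G"
  shows "j \<le> d \<Longrightarrow> \<exists>xs. path_in G xs \<and> length xs = Suc j \<and> last xs = v"
proof (induction j)
  case 0
  then show ?case
    using v by (intro exI[of _ "[v]"]) (auto simp: path_in_def)
next
  case (Suc j)
  then obtain xs where xs: "path_in G xs" "length xs = Suc j" "last xs = v"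
    by auto
  then have ne: "xs \<noteq> []" by auto
  then have h: "hd xs \<in> verts G"
    using xs by (auto simp: path_in_def)
  have "card (set xs - {hd xs}) = j"
    using xs ne by (simp add: path_in_def distinct_card)
  then have "\<not> nbrs G (hd xs) \<subseteq> set xs - {hd xs}"
    using deg[OF h] Suc.prems card_mono[of "set xs - {hd xs}" "nbrs G (hd xs)"] by force
  then obtain y where "y \<in> nbrs G (hd xs)" "y \<notin> set xs"
    using nbrs_subset[OF G, of "hd xs"] by auto
  then show ?case
    using path_in_Cons[OF G xs(1) ne] xs ne by (intro exI[of _ "y # xs"]) auto
qed

lemma path_in_rotate:
  assumes "path_in G (xs @ ys)" "xs \<noteq> []" "ys \<noteq> []" "hd xs \<in> nbrs G (last ys)"
  shows "path_in G (ys @ xs)"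
  using assms by (auto simp: path_in_def successively_append_iff)

section \<open>Path-free graphs of large minimum degree\<close>

text \<open>\<open>S\<close> is the vertex set of a greedy path ending in \<open>v\<close>. Equal
  closed neighbourhoods throughout \<open>S\<close> make it a clique and a whole component.\<close>

lemma closed_nbhd_clique:
  assumes G: "finite_simple_graph G" and deg: "\<And>x. x \<in> verts G \<Longrightarrow> d \<le> card (nbrs G x)"
    and no: "\<not> contains_graph G (path_graph (Suc (Suc d)))" and v: "v \<in> verts G"
  obtains S where "card S = Suc d" "\<And>w. w \<in> S \<Longrightarrow> insert w (nbrs G w) = S" "v \<in> S"
proof -
  obtain xs where xs: "path_in G xs" "length xs = Suc d" "last xs = v"
    using greedy_path[OF G deg v, of d] by auto
  \<comment> \<open>A neighbour of the head off the path would extend it to \<open>d + 2\<close>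
    vertices. So the closed neighbourhood, of size at least \<open>d + 1\<close>, lies in a set of
    \<open>d + 1\<close> elements and fills it.\<close>
  have endpoint: "insert (hd ys) (nbrs G (hd ys)) = set ys"
    if ys: "path_in G ys" "length ys = Suc d" for ys
  proof -
    have ne: "ys \<noteq> []" using ys by auto
    have "nbrs G (hd ys) \<subseteq> set ys"
    proof
      fix y assume "y \<in> nbrs G (hd ys)"
      then show "y \<in> set ys"
        using no path_in_Cons[OF G ys(1) ne, of y] contains_pathI[of G "y # ys"] ys(2) by auto
    qed
    then have "insert (hd ys) (nbrs G (hd ys)) \<subseteq> set ys"
      using ne by simp
    moreover have "card (set ys) = Suc d"
      using ys by (simp add: path_in_def distinct_card)
    moreover have "Suc d \<le> card (insert (hd ys) (nbrs G (hd ys)))"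
    proof -
      have "hd ys \<notin> nbrs G (hd ys)" "hd ys \<in> verts G"
        using nbrs_subset[OF G, of "hd ys"] ys ne by (auto simp: path_in_def)
      then show ?thesis
        using finite_nbrs[OF G] deg by simp
    qed
    ultimately show ?thesis
      by (intro card_seteq) auto
  qed
  have "insert w (nbrs G w) = set xs" if "w \<in> set xs" for w
  proof -
    obtain as bs where ab: "xs = as @ w # bs"
      using \<open>w \<in> set xs\<close> by (auto simp: in_set_conv_decomp)
    show ?thesis
    proof (cases "as = []")
      case True
      then show ?thesis using endpoint[OF xs(1,2)] ab by simp
    next
      case False
      \<comment> \<open>The head is adjacent to all other path vertices, in particular to the last
        one. This edge closes a cycle, which is then cut open so as to start at
        \<open>w\<close>.\<close>
      have "last xs \<in> insert (hd xs) (nbrs G (hd xs))"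
        using endpoint[OF xs(1,2)] ab by auto
      moreover have "last xs \<noteq> hd xs"
        using xs(1) False ab by (cases as) (auto simp: path_in_def)
      ultimately have "hd as \<in> nbrs G (last (w # bs))"
        using False ab nbrs_sym[of "hd xs" G "last xs"] by auto
      then have "path_in G ((w # bs) @ as)"
        using path_in_rotate[of G as "w # bs"] xs(1) ab False by auto
      then show ?thesis
        using endpoint[of "(w # bs) @ as"] xs(2) ab by auto
    qed
  qed
  moreover have "v \<in> set xs"
    using xs by (cases xs rule: rev_cases) auto
  moreover have "card (set xs) = Suc d"
    using xs by (simp add: path_in_def distinct_card)
  ultimately show ?thesis
    using that[of "set xs"] by blast
qed

text \<open>Closed neighbourhoods that meet coincide, so they partition the vertices into blocks of
  size \<open>d + 1\<close>.\<close>

lemma path_free_min_degree_dvd: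
  assumes G: "finite_simple_graph G" and deg: "\<And>x. x \<in> verts G \<Longrightarrow> d \<le> card (nbrs G x)"
    and no: "\<not> contains_graph G (path_graph (Suc (Suc d)))"
  shows "Suc d dvd card (verts G)"
proof -
  define B where "B x = insert x (nbrs G x)" for x
  have fin: "finite (verts G)"
    using G by (simp add: finite_simple_graph_def)
  have cls: "card (B v) = Suc d \<and> (\<forall>w\<in>B v. B w = B v)" if "v \<in> verts G" for v
    using closed_nbhd_clique[OF G deg no that] by (metis B_def)
  have U: "\<Union> (B ` verts G) = verts G"
    using nbrs_subset[OF G] by (auto simp: B_def)
  have "Suc d * card (B ` verts G) = card (\<Union> (B ` verts G))"
  proof (rule card_partition)
    fix c1 c2 assume c: "c1 \<in> B ` verts G" "c2 \<in> B ` verts G" "c1 \<noteq> c2"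
    then show "c1 \<inter> c2 = {}"
      using cls by blast
  qed (use fin U cls in auto)
  then show ?thesis
    using U by (metis dvd_triv_left)
qed

text \<open>Each vertex has \<open>n + d - 1\<close> possible neighbours, and fewer than
  \<open>n\<close> of them are taken in \<open>G\<close>.\<close>

lemma min_degree_complement:
  assumes G: "finite_simple_graph G" and c: "card (verts G) = n + d" and n: "n > 0"
    and no: "\<not> contains_graph G (star_graph (Suc n))" and x: "x \<in> verts (complement_graph G)"
  shows "d \<le> card (nbrs (complement_graph G) x)"
proof -
  have x': "x \<in> verts G"
    using x by (simp add: complement_graph_def)
  then have "card (nbrs G x) < n"
    using no contains_star_iff[OF G, of "Suc n"] by auto
  then show ?thesis
    using card_nbrs_complement[OF G x'] c by simp
qed

section \<open>Extremal graphs\<close>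

text \<open>Residues modulo \<open>q\<close> split \<open>{..<N}\<close> into classes with between
  \<open>m\<close> and \<open>K\<close> elements. Joining different classes gives degrees at most
  \<open>N - m < n\<close>, and a path in the complement never leaves its class. Restriction to the
  first \<open>M\<close> vertices covers all smaller orders at once.\<close>

lemma extremal_graph:
  assumes MN: "M \<le> N" and q: "q > 0" and up: "N \<le> q * K" and lo: "q * m \<le> N"
    and n: "N < n + m"
  shows "\<exists>\<Gamma> :: nat graph. finite_simple_graph \<Gamma> \<and> card (verts \<Gamma>) = M \<and>
           \<not> contains_graph \<Gamma> (star_graph (Suc n)) \<and>
           \<not> contains_graph (complement_graph \<Gamma>) (path_graph (Suc K))"
proof -
  define E where "E = {{x, y} |x y. x < M \<and> y < M \<and> x mod q \<noteq> y mod q}"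
  \<comment> \<open>Classes are taken in \<open>{..<N}\<close>, not in the vertex set
    \<open>{..<M}\<close>, so that the lower bound on their size survives when
    \<open>M < N\<close>.\<close>
  define F where "F c = {i. i < N \<and> i mod q = c mod q}" for c
  have E_iff: "{x, y} \<in> E \<longleftrightarrow> x < M \<and> y < M \<and> x mod q \<noteq> y mod q" for x y
    unfolding E_def by (auto simp: doubleton_eq_iff)
  have G: "finite_simple_graph ({..<M}, E)"
    by (auto simp: finite_simple_graph_def E_def)
  have finF: "finite (F c)" for c
    unfolding F_def by simp
  have F_le: "card (F c) \<le> K" for c
  proof -
    \<comment> \<open>Within a residue class an element is determined by its quotient, and at most
      \<open>K\<close> quotients occur.\<close>
    have "inj_on (\<lambda>i. i div q) (F c)"
      by (rule inj_onI) (metis (mono_tags, lifting) F_def div_mult_mod_eq mem_Collect_eq)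
    moreover have "(\<lambda>i. i div q) ` F c \<subseteq> {..<K}"
      using up q by (auto simp: F_def less_mult_imp_div_less mult.commute)
    ultimately show ?thesis
      using card_inj_on_le[of "\<lambda>i. i div q" "F c" "{..<K}"] by simp
  qed
  have F_ge: "m \<le> card (F c)" for c
  proof -
    \<comment> \<open>The class of \<open>c\<close> contains the first \<open>m\<close> terms of the
      progression from \<open>c mod q\<close> with step \<open>q\<close>.\<close>
    have "c mod q + q * j < N" if "j < m" for j
    proof -
      have "c mod q + q * j < q * Suc j" using q by simp
      also have "\<dots> \<le> q * m" using that by (intro mult_le_mono2) simp
      finally show ?thesis using lo by simp
    qed
    then have "(\<lambda>j. c mod q + q * j) ` {..<m} \<subseteq> F c"
      by (auto simp: F_def)
    moreover have "inj_on (\<lambda>j. c mod q + q * j) {..<m}"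
      using q by (auto simp: inj_on_def)
    ultimately show ?thesis
      using card_inj_on_le[of "\<lambda>j. c mod q + q * j" "{..<m}" "F c"] finF by simp
  qed
  have "\<not> contains_graph ({..<M}, E) (star_graph (Suc n))"
  proof
    assume "contains_graph ({..<M}, E) (star_graph (Suc n))"
    then obtain c where "n \<le> card (nbrs ({..<M}, E) c)"
      using contains_star_iff[OF G, of "Suc n"] by auto
    also have "\<dots> \<le> card ({..<N} - F c)"
      using MN by (intro card_mono) (auto simp: nbrs_def E_iff F_def)
    also have "\<dots> = N - card (F c)"
      using finF by (subst card_Diff_subset) (auto simp: F_def)
    finally have "n \<le> N - card (F c)" .
    moreover have "card (F c) \<le> N"
      using card_mono[of "{..<N}" "F c"] by (auto simp: F_def)
    ultimately show False
      using F_ge[of c] n by simp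
  qed
  moreover have "\<not> contains_graph (complement_graph ({..<M}, E)) (path_graph (Suc K))"
  proof
    assume "contains_graph (complement_graph ({..<M}, E)) (path_graph (Suc K))"
    then obtain f where f': "inj_on f (verts (path_graph (Suc K)))"
        "f ` verts (path_graph (Suc K)) \<subseteq> verts (complement_graph ({..<M}, E))"
        "\<forall>e\<in>edges (path_graph (Suc K)). f ` e \<in> edges (complement_graph ({..<M}, E))"
      unfolding contains_graph_def by blast
    have f: "inj_on f {..<Suc K}" "f ` {..<Suc K} \<subseteq> {..<M}"
      using f' by (simp_all add: path_graph_def complement_graph_def)
    have e: "f ` {i, Suc i} \<in> [{..<M}]\<^bsup>2\<^esup> - E" if "Suc i < Suc K" for i
    proof -
      have "f ` {i, Suc i} \<in> edges (complement_graph ({..<M}, E))"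
        by (rule bspec[OF f'(3)]) (use that in \<open>auto simp: path_graph_def\<close>)
      then show ?thesis by (simp add: complement_graph_def)
    qed
    \<comment> \<open>Consecutive path vertices are non-adjacent in the constructed graph, so their
      residues agree.\<close>
    have same: "i < Suc K \<Longrightarrow> f i mod q = f 0 mod q" for i
    proof (induction i)
      case (Suc i)
      then show ?case
        using e[of i] by (auto simp: E_iff)
    qed simp
    have "f i < N" if "i < Suc K" for i
      using f(2) MN that by (meson image_subset_iff lessThan_iff less_le_trans)
    then have "f ` {..<Suc K} \<subseteq> F (f 0)"
      using same unfolding F_def by blast
    then have "Suc K \<le> card (F (f 0))"
      using card_inj_on_le[OF f(1)] finF by simp
    then show False
      using F_le[of "f 0"] by simp
  qed
  ultimately show ?thesis
    using G by (intro exI[of _ "({..<M}, E)"]) auto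
qed

section \<open>The Ramsey number of a star and a path\<close>

text \<open>A witness is demanded for every \<open>M\<close> below \<open>T\<close>, so minimality
  follows without an argument that the Ramsey property is monotone in the order.\<close>

lemma ramsey_number_eqI:
  assumes "T > 0"
    and "\<And>\<Gamma> :: nat graph. finite_simple_graph \<Gamma> \<Longrightarrow> card (verts \<Gamma>) = T \<Longrightarrow>
           \<not> contains_graph \<Gamma> H1 \<Longrightarrow> contains_graph (complement_graph \<Gamma>) H2"
    and "\<And>M. M < T \<Longrightarrow> \<exists>\<Gamma> :: nat graph. finite_simple_graph \<Gamma> \<and> card (verts \<Gamma>) = M \<and>
           \<not> contains_graph \<Gamma> H1 \<and> \<not> contains_graph (complement_graph \<Gamma>) H2"
  shows "ramsey_number H1 H2 = T"
  unfolding ramsey_number_def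
proof (rule Least_equality)
  fix M
  assume "0 < M \<and> (\<forall>\<Gamma> :: nat graph. finite_simple_graph \<Gamma> \<and> card (verts \<Gamma>) = M \<longrightarrow>
            contains_graph \<Gamma> H1 \<or> contains_graph (complement_graph \<Gamma>) H2)"
  then show "T \<le> M"
    using assms(3)[of M] by (meson not_le)
qed (use assms in blast)

text \<open>Here the star has \<open>n\<close> leaves and the path \<open>d + 1\<close> edges, so
  \<open>n - 1\<close> and \<open>Suc d\<close> stand for the \<open>n - 2\<close> and
  \<open>k - 1\<close> of the theorem.\<close>

lemma ramsey_star_path_dvd:
  assumes "n > 0" and "Suc d dvd n - 1"
  shows "ramsey_number (star_graph (Suc n)) (path_graph (Suc (Suc d))) = Suc (n + d)"
proof (rule ramsey_number_eqI)
  fix \<Gamma> :: "nat graph"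
  assume G: "finite_simple_graph \<Gamma>" and c: "card (verts \<Gamma>) = Suc (n + d)"
    and no: "\<not> contains_graph \<Gamma> (star_graph (Suc n))"
  have deg: "Suc d \<le> card (nbrs (complement_graph \<Gamma>) x)"
    if "x \<in> verts (complement_graph \<Gamma>)" for x
    using min_degree_complement[OF G, of n "Suc d"] c \<open>n > 0\<close> no that by simp
  have "verts \<Gamma> \<noteq> {}"
    using c by auto
  then obtain v where v: "v \<in> verts (complement_graph \<Gamma>)"
    by (auto simp: complement_graph_def)
  obtain xs where "path_in (complement_graph \<Gamma>) xs" "length xs = Suc (Suc d)"
    using greedy_path[OF finite_simple_graph_complement[OF G] deg v, of "Suc d"] by auto
  then show "contains_graph (complement_graph \<Gamma>) (path_graph (Suc (Suc d)))"
    using contains_pathI by metis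
next
  fix M assume M: "M < Suc (n + d)"
  obtain t where t: "n - 1 = Suc d * t"
    using assms(2) by (elim dvdE)
  \<comment> \<open>The \<open>n + d\<close> points split exactly into \<open>t + 1\<close> classes
    of size \<open>d + 1\<close>, so both size bounds in \<open>extremal_graph\<close> can be
    \<open>Suc d\<close>.\<close>
  then have eq: "n + d = Suc t * Suc d"
    using \<open>n > 0\<close> by (simp add: algebra_simps)
  show "\<exists>\<Gamma> :: nat graph. finite_simple_graph \<Gamma> \<and> card (verts \<Gamma>) = M \<and>
          \<not> contains_graph \<Gamma> (star_graph (Suc n)) \<and>
          \<not> contains_graph (complement_graph \<Gamma>) (path_graph (Suc (Suc d)))"
    by (rule extremal_graph[where N = "n + d" and q = "Suc t" and m = "Suc d"])
      (use M eq in auto)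
qed simp

text \<open>On \<open>n + d\<close> vertices a complement without the path would split into cliques
  of order \<open>d + 1\<close>, against \<open>ndvd\<close>. On fewer vertices, \<open>big\<close>
  ensures that nearly equal classes of size at most \<open>d + 1\<close> have at least
  \<open>d\<close> elements.\<close>

lemma ramsey_star_path_not_dvd:
  assumes "n > 0" and ndvd: "\<not> Suc d dvd n - 1" and big: "d * d \<le> n + d - 1"
  shows "ramsey_number (star_graph (Suc n)) (path_graph (Suc (Suc d))) = n + d"
proof (rule ramsey_number_eqI)
  fix \<Gamma> :: "nat graph"
  assume G: "finite_simple_graph \<Gamma>" and c: "card (verts \<Gamma>) = n + d"
    and no: "\<not> contains_graph \<Gamma> (star_graph (Suc n))"
  have deg: "d \<le> card (nbrs (complement_graph \<Gamma>) x)"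
    if "x \<in> verts (complement_graph \<Gamma>)" for x
    using min_degree_complement[OF G c \<open>n > 0\<close> no that] .
  show "contains_graph (complement_graph \<Gamma>) (path_graph (Suc (Suc d)))"
  proof (rule ccontr)
    assume "\<not> ?thesis"
    then have "Suc d dvd n + d"
      using path_free_min_degree_dvd[OF finite_simple_graph_complement[OF G] deg] c
      by (simp add: complement_graph_def)
    moreover have "n + d = n - 1 + Suc d"
      using \<open>n > 0\<close> by simp
    ultimately show False
      using ndvd by (metis dvd_add_triv_right_iff)
  qed
next
  fix M assume M: "M < n + d"
  define N where "N = n + d - 1"
  \<comment> \<open>\<open>N / (d + 1)\<close> rounded up: the fewest classes that keep all sizes at
    most \<open>d + 1\<close>.\<close>
  define q where "q = (N + d) div Suc d"
  have "d > 0"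
    using ndvd by (cases d) auto
  have rem: "q * Suc d + (N + d) mod Suc d = N + d" "(N + d) mod Suc d < Suc d"
    unfolding q_def by (simp_all only: div_mult_mod_eq mod_less_divisor zero_less_Suc)
  then have up: "N \<le> q * Suc d" and q_le: "q * Suc d \<le> N + d"
    by linarith+
  \<comment> \<open>The goal \<open>q * d \<le> N\<close> is reached after multiplication by
    \<open>Suc d\<close>: \<open>(N + d) * d \<le> N * Suc d\<close> amounts to
    \<open>d * d \<le> N\<close>, which is \<open>big\<close>.\<close>
  have "q * d * Suc d \<le> (N + d) * d"
    using mult_le_mono1[OF q_le, of d] by (simp only: mult.assoc mult.commute[of d])
  also have "\<dots> \<le> N * Suc d"
    using big unfolding N_def[symmetric] by (simp add: add_mult_distrib)
  finally have lo: "q * d \<le> N"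
    by (metis mult_le_cancel2 zero_less_Suc)
  have "q > 0"
    using up \<open>n > 0\<close> \<open>d > 0\<close> by (cases q) (auto simp: N_def)
  then show "\<exists>\<Gamma> :: nat graph. finite_simple_graph \<Gamma> \<and> card (verts \<Gamma>) = M \<and>
          \<not> contains_graph \<Gamma> (star_graph (Suc n)) \<and>
          \<not> contains_graph (complement_graph \<Gamma>) (path_graph (Suc (Suc d)))"
    using M \<open>n > 0\<close> up lo
    by (intro extremal_graph[where N = N and q = q and m = d]) (auto simp: N_def)
qed (use assms in simp)

theorem corollary1p2:
  fixes n k :: nat
  assumes "k \<ge> 2" and "n \<ge> 20 * k\<^sup>2"
  shows "ramsey_number (star_graph n) (path_graph k) =
           n + k - 2 - (if k - 1 dvd n - 2 then 0 else 1)"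
proof -
  define d where "d = k - 2"
  define m where "m = n - 1"
  \<comment> \<open>From \<open>k * k \<le> n\<close> come both \<open>d * d \<le> m + d - 1\<close>
    and, since \<open>k \<ge> 2\<close>, also \<open>m > 0\<close>.\<close>
  have "k * k \<le> n"
    using assms(2) by (simp add: power2_eq_square)
  moreover have "2 * 2 \<le> k * k"
    using assms(1) by (intro mult_le_mono)
  moreover have k: "k = Suc (Suc d)"
    using assms(1) by (simp add: d_def)
  ultimately have n: "n = Suc m" and m: "m > 0" "d * d \<le> m + d - 1"
    by (auto simp: m_def)
  show ?thesis
    using ramsey_star_path_dvd[OF m(1), of d] ramsey_star_path_not_dvd[OF m(1) _ m(2)]
    by (auto simp: n k numeral_2_eq_2)
qed

end
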